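(* Let $F$ be a smooth real function on an open subset $U$ of $\mathbb{E}^3$ and $\Sigma=F^{-1}(c)$. If $\alpha:I\to\Sigma\subset\mathbb{E}^3$ is a $C^2$ regular curve parametrized by arc-length, then its normal development $(\kappa_1(s),\kappa_2(s))$ satisfies $$b_2(s)\kappa_2(s)+b_1(s)\kappa_1(s)+b_0(s)=0,\qquad(\ast)$$ where $b_0=\langle(\mathrm{Hess}\,F)\,\mathbf t,\mathbf t\rangle$, $b_i=\langle\nabla_\alpha F,\mathbf n_i\rangle$, and $b_i'(s)=\langle(\mathrm{Hess}\,F)\,\mathbf t,\mathbf n_i\rangle$, $i=1,2$, and $\{\mathbf t,\mathbf n_1,\mathbf n_2\}$ is a rotation minimizing frame along $\alpha$ with respect to the usual metric of $\mathbb{E}^3$. Conversely, if $\alpha:I\to U$ is a $C^2$ regular arc-length parametrized curve for which $(\ast)$ holds with $b_0=\langle(\mathrm{Hess}\,F)\,\mathbf t,\mathbf t\rangle$ and $b_i=\langle\nabla_\alpha F,\mathbf n_i\rangle$, and $\langle\nabla_{\alpha(s_0)}F,\mathbf t(s_0)\rangle=0$ at some point $\alpha(s_0)$, then $\alpha$ lies in a level surface of $F$.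
   Context: $\mathbb{E}^3$ is $\mathbb{R}^3$ with the standard inner product; $\nabla F$ and $\mathrm{Hess}\,F=(\partial^2F/\partial x^i\partial x^j)$ are the usual gradient and Hessian. A rotation minimizing frame along $\alpha$ is an orthonormal frame $\{\mathbf t,\mathbf n_1,\mathbf n_2\}$ with $\mathbf t=\alpha'$ and $\mathbf n_i'=-\kappa_i\mathbf t$; then $\mathbf t'=\kappa_1\mathbf n_1+\kappa_2\mathbf n_2$. The curve $(\kappa_1,\kappa_2)$ is the normal development of $\alpha$. *)

theory Defs
  imports "HOL-Analysis.Analysis"
begin

(* Derivatives are taken within S.  The notion is meant for sets S on which these are
   unique; here S is an open set or a nondegenerate interval (one-sided derivatives at
   endpoints that belong to the interval). *)
fun Ck_on :: "nat \<Rightarrow> ('a::real_normed_vector \<Rightarrow> 'b::real_normed_vector) \<Rightarrow> 'a set \<Rightarrow> bool" where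
  "Ck_on 0 f S \<longleftrightarrow> continuous_on S f"
| "Ck_on (Suc k) f S \<longleftrightarrow>
     f differentiable_on S \<and> (\<forall>v. Ck_on k (\<lambda>x. frechet_derivative f (at x within S) v) S)"

definition smooth_on :: "('a::real_normed_vector \<Rightarrow> 'b::real_normed_vector) \<Rightarrow> 'a set \<Rightarrow> bool" where
  "smooth_on f S \<longleftrightarrow> (\<forall>k. Ck_on k f S)"

definition grad :: "('a::real_inner \<Rightarrow> real) \<Rightarrow> 'a \<Rightarrow> 'a" where
  "grad F x = (SOME D. GDERIV F x :> D)"

definition partial :: "'n::finite \<Rightarrow> (real^'n \<Rightarrow> real) \<Rightarrow> real^'n \<Rightarrow> real" where
  "partial i F x = frechet_derivative F (at x) (axis i 1)"

definition Hess :: "(real^'n::finite \<Rightarrow> real) \<Rightarrow> real^'n \<Rightarrow> real^'n^'n" where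
  "Hess F x = (\<chi> i j. partial i (partial j F) x)"

definition level_set :: "('a \<Rightarrow> real) \<Rightarrow> 'a set \<Rightarrow> real \<Rightarrow> 'a set" where
  "level_set F U c = {x \<in> U. F x = c}"

definition nondegenerate_interval :: "real set \<Rightarrow> bool" where
  "nondegenerate_interval I \<longleftrightarrow> is_interval I \<and> interior I \<noteq> {}"

(* Parametrization by arc length; regularity (nonvanishing velocity) is implied. *)
definition unit_speed_on :: "(real \<Rightarrow> 'a::real_normed_vector) \<Rightarrow> real set \<Rightarrow> bool" where
  "unit_speed_on \<alpha> I \<longleftrightarrow> (\<forall>s\<in>I. norm (vector_derivative \<alpha> (at s within I)) = 1)"

(* The equation t' = k1 n1 + k2 n2 is not imposed: for C^2 curves it follows
   from orthonormality and the equations for the n_i. *)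
definition rotation_minimizing_frame ::
    "(real \<Rightarrow> real^3) \<Rightarrow> real set \<Rightarrow> (real \<Rightarrow> real^3) \<Rightarrow> (real \<Rightarrow> real^3) \<Rightarrow> (real \<Rightarrow> real^3)
      \<Rightarrow> (real \<Rightarrow> real) \<Rightarrow> (real \<Rightarrow> real) \<Rightarrow> bool" where
  "rotation_minimizing_frame \<alpha> I t n1 n2 \<kappa>1 \<kappa>2 \<longleftrightarrow>
     (\<forall>s\<in>I. t s = vector_derivative \<alpha> (at s within I)
        \<and> norm (t s) = 1 \<and> norm (n1 s) = 1 \<and> norm (n2 s) = 1
        \<and> t s \<bullet> n1 s = 0 \<and> t s \<bullet> n2 s = 0 \<and> n1 s \<bullet> n2 s = 0
        \<and> (n1 has_vector_derivative - \<kappa>1 s *\<^sub>R t s) (at s within I)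
        \<and> (n2 has_vector_derivative - \<kappa>2 s *\<^sub>R t s) (at s within I))"

end

theory Submission
  imports Defs
begin

text \<open>
  Let \<open>\<phi> = F \<circ> \<alpha>\<close>. The chain rule gives \<open>\<phi>' = \<langle>\<nabla>F, t\<rangle>\<close>. Differentiating once more, with
  \<open>t' = \<kappa>1 n1 + \<kappa>2 n2\<close>, gives \<open>\<phi>'' = \<langle>(Hess F) t, t\<rangle> + \<kappa>1 \<langle>\<nabla>F, n1\<rangle> + \<kappa>2 \<langle>\<nabla>F, n2\<rangle>\<close>,
  which is exactly \<open>b0 + b1 \<kappa>1 + b2 \<kappa>2\<close>. So the linear relation between the curvatures
  says \<open>\<phi>'' = 0\<close>. If the curve lies on a level surface then \<open>\<phi>\<close> is constant and the relation
  holds. Conversely the relation makes \<open>\<phi>'\<close> constant, one point of tangency makes it zero,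
  and hence \<open>\<phi>\<close> is constant. On a level surface \<open>\<langle>\<nabla>F, t\<rangle> = 0\<close>, and since \<open>ni'\<close> is a
  multiple of \<open>t\<close>, the product rule leaves only \<open>bi' = \<langle>(Hess F) t, ni\<rangle>\<close>,
  for \<open>i = 1, 2\<close>.

  Two facts carry this computation. The first is that the gradient is differentiable with
  derivative \<open>v \<mapsto> (Hess F) v\<close> (\<open>grad_has_derivative_Hess\<close>). Differentiating \<open>\<nabla>F\<close>
  componentwise naturally produces the transposed Hessian, so this needs the equality of mixed
  partial derivatives (\<open>second_derivative_symmetric\<close>). The second is the formula for \<open>t'\<close>
  (\<open>rotation_minimizing_frame_tangent_derivative\<close>), obtained by differentiating the
  orthonormality relations. All derivatives along the curve are one-sided at endpoints that
  belong to the interval; they are unique because a nondegenerate interval has no isolated point.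
\<close>

section \<open>Symmetry of second derivatives\<close>

text \<open>
  The numerator is an expression in which \<open>v\<close> and \<open>w\<close> play the same role, whereas the limit is
  computed by differentiating first along \<open>v\<close> and then along \<open>w\<close>; this is what forces symmetry.
  The numerator is an increment, over \<open>t\<close> from \<open>0\<close> to \<open>h\<close>, of
  \<open>f (x + t v + h w) - f (x + t v)\<close>. By the mean value theorem it is \<open>h\<close> times a difference of
  two values of \<open>G y v\<close> at points within distance \<open>O(h)\<close> of \<open>x\<close>; the linear approximation of
  \<open>G y v\<close> at \<open>x\<close> turns that difference into \<open>h A w + o(h)\<close>.
\<close>
lemma second_difference_quotient_tendsto:
  fixes f :: "'a::real_normed_vector \<Rightarrow> real"
  assumes "open S" "x \<in> S"
    and f: "\<And>y. y \<in> S \<Longrightarrow> (f has_derivative G y) (at y)"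
    and G: "((\<lambda>y. G y v) has_derivative A) (at x)"
  shows "((\<lambda>h. (f (x + h *\<^sub>R v + h *\<^sub>R w) - f (x + h *\<^sub>R v) - f (x + h *\<^sub>R w) + f x) / h\<^sup>2)
           \<longlongrightarrow> A w) (at_right 0)"
proof (rule tendstoI)
  fix e :: real assume e: "e > 0"
  define M where "M = norm v + norm w + 1"
  have M: "M > 0" unfolding M_def by (smt (verit) norm_ge_zero)
  \<comment> \<open>Two linearization errors of size at most \<open>\<epsilon> h M\<close> will add up; the factor 3 keeps their sum,
    divided by \<open>h\<close>, strictly below \<open>e\<close>.\<close>
  define \<epsilon> where "\<epsilon> = e / (3 * M)"
  have \<epsilon>: "\<epsilon> > 0" using e M by (simp add: \<epsilon>_def)
  obtain r where r: "r > 0" "ball x r \<subseteq> S"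
    using assms(1,2) openE by blast
  obtain d where d: "d > 0"
    and Gd: "\<And>y. norm (y - x) < d \<Longrightarrow> norm (G y v - G x v - A (y - x)) \<le> \<epsilon> * norm (y - x)"
    using G \<epsilon> unfolding has_derivative_at_alt by blast
  have linA: "linear A" using G has_derivative_linear by blast
  define \<delta> where "\<delta> = min r d / M"
  have \<delta>: "\<delta> > 0" using r d M by (simp add: \<delta>_def)
  have "dist ((f (x + h *\<^sub>R v + h *\<^sub>R w) - f (x + h *\<^sub>R v) - f (x + h *\<^sub>R w) + f x) / h\<^sup>2) (A w) < e"
    if h: "0 < h" "h < \<delta>" for h
  proof -
    have hM: "h * M < min r d"
      using h M by (simp add: \<delta>_def field_simps)
    have small: "norm (t *\<^sub>R v + k *\<^sub>R w) \<le> h * M"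
      if "0 \<le> t" "t \<le> h" "0 \<le> k" "k \<le> h" for t k
    proof -
      have "norm (t *\<^sub>R v + k *\<^sub>R w) \<le> t * norm v + k * norm w"
        using norm_triangle_ineq[of "t *\<^sub>R v" "k *\<^sub>R w"] that by simp
      also have "\<dots> \<le> h * norm v + h * norm w"
        using that by (intro add_mono mult_right_mono) auto
      also have "\<dots> \<le> h * M" using h by (simp add: M_def algebra_simps)
      finally show ?thesis .
    qed
    have inS: "x + t *\<^sub>R v + k *\<^sub>R w \<in> S" if "0 \<le> t" "t \<le> h" "0 \<le> k" "k \<le> h" for t k
    proof -
      have "dist (x + (t *\<^sub>R v + k *\<^sub>R w)) x < r"
        using small[OF that] hM by (simp add: dist_norm)
      then have "x + (t *\<^sub>R v + k *\<^sub>R w) \<in> ball x r"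
        by (simp only: mem_ball dist_commute)
      then show ?thesis using r by (auto simp: add.assoc)
    qed
    \<comment> \<open>The vacuous term \<open>0 *\<^sub>R w\<close> lets both summands be differentiated by the one fact \<open>der\<close>,
      with \<open>k = h\<close> and \<open>k = 0\<close>.\<close>
    define \<phi> where "\<phi> = (\<lambda>t. f (x + t *\<^sub>R v + h *\<^sub>R w) - f (x + t *\<^sub>R v + 0 *\<^sub>R w))"
    have der: "((\<lambda>t. f (x + t *\<^sub>R v + k *\<^sub>R w)) has_derivative (\<lambda>u. u * G (x + t *\<^sub>R v + k *\<^sub>R w) v)) (at t)"
      if "0 \<le> t" "t \<le> h" "0 \<le> k" "k \<le> h" for t k
    proof -
      have "((\<lambda>t. f (x + t *\<^sub>R v + k *\<^sub>R w)) has_derivative (\<lambda>u. G (x + t *\<^sub>R v + k *\<^sub>R w) (u *\<^sub>R v))) (at t)"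
      proof (rule has_derivative_compose[of "\<lambda>t. x + t *\<^sub>R v + k *\<^sub>R w" "\<lambda>u. u *\<^sub>R v" t UNIV f])
        show "((\<lambda>t. x + t *\<^sub>R v + k *\<^sub>R w) has_derivative (\<lambda>u. u *\<^sub>R v)) (at t)"
          by (auto intro!: derivative_eq_intros)
        show "(f has_derivative G (x + t *\<^sub>R v + k *\<^sub>R w)) (at (x + t *\<^sub>R v + k *\<^sub>R w))"
          by (rule f[OF inS[OF that]])
      qed
      moreover have "linear (G (x + t *\<^sub>R v + k *\<^sub>R w))"
        using f[OF inS[OF that]] has_derivative_linear by blast
      ultimately show ?thesis by (simp add: linear_cmul)
    qed
    define \<phi>' where
      "\<phi>' = (\<lambda>t u. u * G (x + t *\<^sub>R v + h *\<^sub>R w) v - u * G (x + t *\<^sub>R v + 0 *\<^sub>R w) v)"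
    have "(\<phi> has_derivative \<phi>' t) (at t within {0..h})" if "0 \<le> t" "t \<le> h" for t
    proof -
      have "((\<lambda>t. f (x + t *\<^sub>R v + h *\<^sub>R w)) has_derivative (\<lambda>u. u * G (x + t *\<^sub>R v + h *\<^sub>R w) v)) (at t)"
        using h by (intro der that) simp_all
      moreover have "((\<lambda>t. f (x + t *\<^sub>R v + 0 *\<^sub>R w)) has_derivative (\<lambda>u. u * G (x + t *\<^sub>R v + 0 *\<^sub>R w) v)) (at t)"
        using h by (intro der that) simp_all
      ultimately show ?thesis
        unfolding \<phi>_def \<phi>'_def by (rule has_derivative_at_withinI[OF has_derivative_diff])
    qed
    then obtain \<theta> where \<theta>: "0 < \<theta>" "\<theta> < h" and "\<phi> h - \<phi> 0 = \<phi>' \<theta> (h - 0)"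
      using mvt_simple[OF h(1), of \<phi> \<phi>'] by auto
    then have mv: "\<phi> h - \<phi> 0 = h * (G (x + \<theta> *\<^sub>R v + h *\<^sub>R w) v - G (x + \<theta> *\<^sub>R v + 0 *\<^sub>R w) v)"
      by (simp only: \<phi>'_def diff_zero right_diff_distrib)
    have lin_error: "\<bar>G (x + \<theta> *\<^sub>R v + k *\<^sub>R w) v - G x v - A (\<theta> *\<^sub>R v + k *\<^sub>R w)\<bar> \<le> \<epsilon> * (h * M)"
      if "0 \<le> k" "k \<le> h" for k
    proof -
      have n: "norm (\<theta> *\<^sub>R v + k *\<^sub>R w) \<le> h * M" using small \<theta> that by simp
      then have "norm (G (x + (\<theta> *\<^sub>R v + k *\<^sub>R w)) v - G x v - A (\<theta> *\<^sub>R v + k *\<^sub>R w))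
                  \<le> \<epsilon> * norm (\<theta> *\<^sub>R v + k *\<^sub>R w)"
        using Gd[of "x + (\<theta> *\<^sub>R v + k *\<^sub>R w)"] hM by simp
      also have "\<dots> \<le> \<epsilon> * (h * M)" using n \<epsilon> by simp
      finally show ?thesis by (simp add: add.assoc)
    qed
    \<comment> \<open>The unknown intermediate point \<open>\<theta>\<close> cancels from the linear parts.\<close>
    have "A (\<theta> *\<^sub>R v + h *\<^sub>R w) - A (\<theta> *\<^sub>R v + 0 *\<^sub>R w) = h * A w"
      using linA by (simp add: linear_add linear_cmul)
    then have "\<bar>G (x + \<theta> *\<^sub>R v + h *\<^sub>R w) v - G (x + \<theta> *\<^sub>R v + 0 *\<^sub>R w) v - h * A w\<bar> \<le> 2 * (\<epsilon> * (h * M))"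
      using lin_error[of h] lin_error[of 0] h by linarith
    also have "2 * (\<epsilon> * (h * M)) < h * e"
      using h e M by (simp add: \<epsilon>_def)
    finally have "\<bar>(G (x + \<theta> *\<^sub>R v + h *\<^sub>R w) v - G (x + \<theta> *\<^sub>R v + 0 *\<^sub>R w) v) / h - A w\<bar> < e"
      using h by (simp add: abs_less_iff field_simps)
    moreover have "(f (x + h *\<^sub>R v + h *\<^sub>R w) - f (x + h *\<^sub>R v) - f (x + h *\<^sub>R w) + f x) / h\<^sup>2
        = (G (x + \<theta> *\<^sub>R v + h *\<^sub>R w) v - G (x + \<theta> *\<^sub>R v + 0 *\<^sub>R w) v) / h"
    proof -
      have "f (x + h *\<^sub>R v + h *\<^sub>R w) - f (x + h *\<^sub>R v) - f (x + h *\<^sub>R w) + f x = \<phi> h - \<phi> 0"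
        by (simp add: \<phi>_def)
      then show ?thesis unfolding mv using h by (simp add: power2_eq_square)
    qed
    ultimately show ?thesis by (simp add: dist_real_def)
  qed
  then show "\<forall>\<^sub>F h in at_right 0.
      dist ((f (x + h *\<^sub>R v + h *\<^sub>R w) - f (x + h *\<^sub>R v) - f (x + h *\<^sub>R w) + f x) / h\<^sup>2) (A w) < e"
    unfolding eventually_at_right_field using \<delta> by auto
qed

lemma second_derivative_symmetric:
  fixes f :: "'a::real_normed_vector \<Rightarrow> real"
  assumes "open S" "x \<in> S"
    and "\<And>y. y \<in> S \<Longrightarrow> (f has_derivative G y) (at y)"
    and "((\<lambda>y. G y v) has_derivative A) (at x)"
    and "((\<lambda>y. G y w) has_derivative B) (at x)"
  shows "A w = B v"
proof -
  have "((\<lambda>h. (f (x + h *\<^sub>R w + h *\<^sub>R v) - f (x + h *\<^sub>R w) - f (x + h *\<^sub>R v) + f x) / h\<^sup>2)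
           \<longlongrightarrow> B v) (at_right 0)"
    by (rule second_difference_quotient_tendsto[OF assms(1-3,5)])
  then have "((\<lambda>h. (f (x + h *\<^sub>R v + h *\<^sub>R w) - f (x + h *\<^sub>R v) - f (x + h *\<^sub>R w) + f x) / h\<^sup>2)
           \<longlongrightarrow> B v) (at_right 0)"
    by (simp add: algebra_simps)
  with second_difference_quotient_tendsto[OF assms(1-4)] show ?thesis
    by (rule tendsto_unique[OF trivial_limit_at_right_real])
qed

section \<open>Gradient and Hessian\<close>

text \<open>
  In finite dimension the derivative, being linear, is the inner product with the vector whose
  coordinates are its values on an orthonormal basis; so a gradient exists and the choice in \<open>grad\<close> is a genuine one.
\<close>
lemma has_derivative_grad:
  fixes F :: "'a::euclidean_space \<Rightarrow> real"
  assumes "F differentiable (at x)"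
  shows "(F has_derivative (\<lambda>v. grad F x \<bullet> v)) (at x)"
proof -
  obtain F' where F': "(F has_derivative F') (at x)"
    using assms by (auto simp: differentiable_def)
  have "F' v = v \<bullet> (\<Sum>b\<in>Basis. F' b *\<^sub>R b)" for v
  proof -
    have "F' v = F' (\<Sum>b\<in>Basis. (v \<bullet> b) *\<^sub>R b)" by (simp add: euclidean_representation)
    also have "\<dots> = (\<Sum>b\<in>Basis. (v \<bullet> b) * F' b)"
      using has_derivative_linear[OF F'] by (simp add: linear_sum linear_cmul)
    also have "\<dots> = v \<bullet> (\<Sum>b\<in>Basis. F' b *\<^sub>R b)"
      by (simp add: inner_sum_right mult.commute)
    finally show ?thesis .
  qed
  then have "GDERIV F x :> (\<Sum>b\<in>Basis. F' b *\<^sub>R b)"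
    using F' unfolding gderiv_def by (metis (no_types, lifting) ext)
  then have "GDERIV F x :> grad F x"
    unfolding grad_def by (rule someI)
  then show ?thesis by (simp add: gderiv_def inner_commute)
qed

lemma partial_eq_grad:
  fixes F :: "real^'n \<Rightarrow> real"
  assumes "F differentiable (at x)"
  shows "partial i F x = grad F x $ i"
  unfolding partial_def frechet_derivative_at[OF has_derivative_grad[OF assms], symmetric]
  by (simp add: inner_axis)

text \<open>
  The \<open>j\<close>-th component of the gradient is \<open>partial j F\<close>, whose derivative along \<open>v\<close> contracts
  \<open>v\<close> with the \<open>j\<close>-th column of the Hessian, while \<open>Hess F x *v v\<close> contracts it with the
  \<open>j\<close>-th row. Symmetry of the Hessian reconciles the two.
\<close>
lemma grad_has_derivative_Hess:
  fixes F :: "real^'n \<Rightarrow> real"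
  assumes "open U" "x \<in> U" and C2: "Ck_on 2 F U"
  shows "(grad F has_derivative (\<lambda>v. Hess F x *v v)) (at x)"
proof -
  have F1: "F differentiable (at y)" if "y \<in> U" for y
    using C2 assms(1) that by (auto simp: numeral_2_eq_2 differentiable_on_eq_differentiable_at)
  \<comment> \<open>\<open>Ck_on\<close> speaks of derivatives within \<open>U\<close>, \<open>partial\<close> of derivatives at the point; on the open
    set \<open>U\<close> they agree.\<close>
  have part: "(partial j F has_derivative frechet_derivative (partial j F) (at x)) (at x)" for j
  proof -
    have "(\<lambda>y. frechet_derivative F (at y within U) (axis j 1)) differentiable (at x)"
      using C2 assms(1,2)
      by (auto simp: numeral_2_eq_2 differentiable_on_eq_differentiable_at)
    then have "((\<lambda>y. frechet_derivative F (at y within U) (axis j 1)) has_derivative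
        frechet_derivative (\<lambda>y. frechet_derivative F (at y within U) (axis j 1)) (at x)) (at x)"
      by (simp add: frechet_derivative_works)
    then have "(partial j F has_derivative
        frechet_derivative (\<lambda>y. frechet_derivative F (at y within U) (axis j 1)) (at x)) (at x)"
      by (rule has_derivative_transform_within_open[OF _ assms(1,2)])
         (simp add: partial_def at_within_open[OF _ assms(1)])
    then show ?thesis
      using frechet_derivative_works differentiable_def by blast
  qed
  have sym: "Hess F x $ i $ j = Hess F x $ j $ i" for i j
  proof -
    have "frechet_derivative (partial j F) (at x) (axis i 1)
        = frechet_derivative (partial i F) (at x) (axis j 1)"
      by (rule second_derivative_symmetric[OF assms(1,2), of F "\<lambda>y. frechet_derivative F (at y)"])
         (use F1 part in \<open>auto simp: partial_def[abs_def] frechet_derivative_works[symmetric]\<close>)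
    then show ?thesis by (simp add: Hess_def partial_def[of _ "partial _ _"])
  qed
  have "frechet_derivative (partial j F) (at x) v = (Hess F x *v v) $ j" for j v
  proof -
    have lin: "linear (frechet_derivative (partial j F) (at x))"
      using part has_derivative_linear by blast
    have "frechet_derivative (partial j F) (at x) v
        = frechet_derivative (partial j F) (at x) (\<Sum>i\<in>UNIV. v $ i *\<^sub>R axis i 1)"
      by (simp add: basis_expansion scalar_mult_eq_scaleR[symmetric])
    also have "\<dots> = (\<Sum>i\<in>UNIV. v $ i * Hess F x $ i $ j)"
      using lin by (simp add: linear_sum linear_cmul Hess_def partial_def[of _ "partial _ _"])
    also have "\<dots> = (Hess F x *v v) $ j"
      by (simp add: matrix_vector_mult_def sym[of _ j] mult.commute)
    finally show ?thesis .
  qed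
  then have comp: "((\<lambda>y. partial j F y) has_derivative (\<lambda>v. (Hess F x *v v) $ j)) (at x)" for j
    using part[of j] by (metis (no_types, lifting) ext)
  have "((\<lambda>y. grad F y $ j) has_derivative (\<lambda>v. (Hess F x *v v) $ j)) (at x)" for j
    by (rule has_derivative_transform_within_open[OF comp assms(1,2)])
       (simp add: partial_eq_grad F1)
  then show ?thesis
    by (subst has_derivative_componentwise_within)
       (auto simp: Basis_vec_def inner_axis)
qed

section \<open>Curves and frames\<close>

lemma has_vector_derivative_inner:
  assumes "(f has_vector_derivative f') (at s within I)" "(g has_vector_derivative g') (at s within I)"
  shows "((\<lambda>s. f s \<bullet> g s) has_real_derivative f s \<bullet> g' + f' \<bullet> g s) (at s within I)"
  using bounded_bilinear.has_vector_derivative[OF bounded_bilinear_inner assms]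
  by (simp add: has_real_derivative_iff_has_vector_derivative)

lemma DERIV_of_constant_on:
  fixes f :: "real \<Rightarrow> real"
  assumes "at s within I \<noteq> bot" "s \<in> I" "\<And>u. u \<in> I \<Longrightarrow> f u = c"
    and "(f has_real_derivative d) (at s within I)"
  shows "d = 0"
proof -
  have "(f has_real_derivative 0) (at s within I)"
    by (rule has_field_derivative_transform_within[of "\<lambda>_. c" _ _ _ 1]) (use assms in auto)
  then show ?thesis
    using assms(1,4) vector_derivative_unique_within
    by (metis has_real_derivative_iff_has_vector_derivative)
qed

lemma nondegenerate_interval_perfect:
  assumes "nondegenerate_interval I" "s \<in> I"
  shows "at s within I \<noteq> bot"
proof -
  have "I \<noteq> {a}" for a
    using assms interior_singleton[of a] by (auto simp: nondegenerate_interval_def)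
  then have "s islimpt I"
    using assms by (intro connected_imp_perfect) (auto simp: nondegenerate_interval_def is_interval_connected_1)
  then show ?thesis by (simp add: trivial_limit_within)
qed

lemma frechet_derivative_eq_vector_derivative:
  assumes "f differentiable (at s within I)" "at s within I \<noteq> bot"
  shows "frechet_derivative f (at s within I) 1 = vector_derivative f (at s within I)"
proof -
  have f': "(f has_derivative frechet_derivative f (at s within I)) (at s within I)"
    using assms frechet_derivative_works by blast
  have "frechet_derivative f (at s within I) = (\<lambda>u. u *\<^sub>R frechet_derivative f (at s within I) 1)"
  proof
    fix u :: real
    show "frechet_derivative f (at s within I) u = u *\<^sub>R frechet_derivative f (at s within I) 1"
      using linear_cmul[OF has_derivative_linear[OF f'], of u 1] by simp
  qed
  then have "(f has_vector_derivative frechet_derivative f (at s within I) 1) (at s within I)"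
    using f' by (simp add: has_vector_derivative_def)
  then show ?thesis using vector_derivative_within[OF assms(2)] by metis
qed

text \<open>
  \<open>Ck_on 2\<close> makes the Frechet derivative in direction \<open>1\<close> differentiable; uniqueness of the
  derivative on \<open>I\<close> is what identifies it with the velocity.
\<close>
lemma C2_curve_velocity_differentiable:
  assumes "Ck_on 2 \<alpha> I" "\<And>s. s \<in> I \<Longrightarrow> at s within I \<noteq> bot"
    and t: "\<And>s. s \<in> I \<Longrightarrow> t s = vector_derivative \<alpha> (at s within I)" and "s \<in> I"
  shows "(\<alpha> has_vector_derivative t s) (at s within I)"
    and "t differentiable (at s within I)"
proof -
  have d: "\<alpha> differentiable (at u within I)" if "u \<in> I" for u
    using assms(1) that by (auto simp: numeral_2_eq_2 differentiable_on_def)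
  then show "(\<alpha> has_vector_derivative t s) (at s within I)"
    using assms(4) t vector_derivative_works by metis
  have "(\<lambda>u. frechet_derivative \<alpha> (at u within I) 1) differentiable (at s within I)"
    using assms(1,4) by (auto simp: numeral_2_eq_2 differentiable_on_def)
  then show "t differentiable (at s within I)"
    by (rule differentiable_transform_within[of _ _ _ 1])
       (use assms d in \<open>auto simp: frechet_derivative_eq_vector_derivative\<close>)
qed

lemma orthonormal_triple_expansion:
  fixes a b c x :: "real^3"
  assumes "norm a = 1" "norm b = 1" "norm c = 1" "a \<bullet> b = 0" "a \<bullet> c = 0" "b \<bullet> c = 0"
  shows "x = (x \<bullet> a) *\<^sub>R a + (x \<bullet> b) *\<^sub>R b + (x \<bullet> c) *\<^sub>R c"
proof -
  have nz: "a \<noteq> 0" "b \<noteq> 0" "c \<noteq> 0" using assms by auto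
  have ne: "a \<noteq> b" "a \<noteq> c" "b \<noteq> c" using assms nz by auto
  have po: "pairwise orthogonal {a, b, c}"
    using assms by (auto simp: pairwise_def orthogonal_def inner_commute)
  then have ind: "independent {a, b, c}"
    using nz by (intro pairwise_orthogonal_independent) auto
  have "card {a, b, c} = 3" using ne by simp
  then have "span {a, b, c} = UNIV"
    using ind card_eq_dim[of "{a, b, c}" UNIV] dim_UNIV[where 'a="real^3"] by (auto simp: DIM_cart)
  then have "(\<Sum>v\<in>{a, b, c}. (x \<bullet> v) *\<^sub>R v) = x"
    using assms by (intro orthonormal_basis_expand[OF po]) auto
  then show ?thesis using ne by (simp add: add.assoc)
qed

text \<open>
  The coefficients of \<open>t'\<close> in the frame come from differentiating \<open>\<langle>t, t\<rangle> = 1\<close>, which gives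
  \<open>\<langle>t', t\<rangle> = 0\<close>, and \<open>\<langle>t, ni\<rangle> = 0\<close>, which gives \<open>\<langle>t', ni\<rangle> = - \<langle>t, ni'\<rangle> = \<kappa>i\<close>.
\<close>
lemma rotation_minimizing_frame_tangent_derivative:
  assumes frame: "rotation_minimizing_frame \<alpha> I t n1 n2 \<kappa>1 \<kappa>2"
    and C2: "Ck_on 2 \<alpha> I"
    and perf: "\<And>s. s \<in> I \<Longrightarrow> at s within I \<noteq> bot" and s: "s \<in> I"
  shows "(t has_vector_derivative \<kappa>1 s *\<^sub>R n1 s + \<kappa>2 s *\<^sub>R n2 s) (at s within I)"
proof -
  note fr = frame[unfolded rotation_minimizing_frame_def, rule_format]
  obtain T where T: "(t has_vector_derivative T) (at s within I)"
    using C2_curve_velocity_differentiable(2)[OF C2 perf _ s, of t] fr vector_derivative_works by blast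
  have "t u \<bullet> t u = 1" if "u \<in> I" for u
    using fr[OF that] by (metis dot_square_norm one_power2)
  then have "t s \<bullet> T + T \<bullet> t s = 0"
    by (rule DERIV_of_constant_on[OF perf[OF s] s _ has_vector_derivative_inner[OF T T]])
  then have Tt: "T \<bullet> t s = 0" by (simp add: inner_commute)
  have Tn: "T \<bullet> n s = k"
    if "\<And>u. u \<in> I \<Longrightarrow> t u \<bullet> n u = 0" "(n has_vector_derivative - k *\<^sub>R t s) (at s within I)" for n k
  proof -
    have "t s \<bullet> (- k *\<^sub>R t s) + T \<bullet> n s = 0"
      by (rule DERIV_of_constant_on[OF perf[OF s] s _ has_vector_derivative_inner[OF T that(2)], of 0])
         (use that in auto)
    moreover have "t s \<bullet> t s = 1"
      using fr[OF s] by (metis dot_square_norm one_power2)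
    ultimately show ?thesis by simp
  qed
  have "T = (T \<bullet> t s) *\<^sub>R t s + (T \<bullet> n1 s) *\<^sub>R n1 s + (T \<bullet> n2 s) *\<^sub>R n2 s"
    using fr[OF s] by (intro orthonormal_triple_expansion) auto
  moreover have "T \<bullet> n1 s = \<kappa>1 s" "T \<bullet> n2 s = \<kappa>2 s"
    using fr s by (blast intro: Tn)+
  ultimately have "T = \<kappa>1 s *\<^sub>R n1 s + \<kappa>2 s *\<^sub>R n2 s"
    using Tt by simp
  then show ?thesis using T by simp
qed

section \<open>Normal development of curves on level surfaces\<close>

theorem theorem5p2p2:
  fixes F :: "real^3 \<Rightarrow> real" and U :: "(real^3) set"
    and I :: "real set" and \<alpha> t n1 n2 :: "real \<Rightarrow> real^3"
    and \<kappa>1 \<kappa>2 b0 b1 b2 :: "real \<Rightarrow> real"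
  assumes "open U" and "smooth_on F U"
    and "nondegenerate_interval I"
    and "\<alpha> ` I \<subseteq> U" and "Ck_on 2 \<alpha> I" and "unit_speed_on \<alpha> I"
    and "rotation_minimizing_frame \<alpha> I t n1 n2 \<kappa>1 \<kappa>2"
    and "b0 = (\<lambda>s. (Hess F (\<alpha> s) *v t s) \<bullet> t s)"
    and "b1 = (\<lambda>s. grad F (\<alpha> s) \<bullet> n1 s)"
    and "b2 = (\<lambda>s. grad F (\<alpha> s) \<bullet> n2 s)"
  shows "(\<forall>c. \<alpha> ` I \<subseteq> level_set F U c \<longrightarrow>
            (\<forall>s\<in>I. b2 s * \<kappa>2 s + b1 s * \<kappa>1 s + b0 s = 0
               \<and> (b1 has_real_derivative (Hess F (\<alpha> s) *v t s) \<bullet> n1 s) (at s within I)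
               \<and> (b2 has_real_derivative (Hess F (\<alpha> s) *v t s) \<bullet> n2 s) (at s within I)))
       \<and> ((\<forall>s\<in>I. b2 s * \<kappa>2 s + b1 s * \<kappa>1 s + b0 s = 0)
            \<and> (\<exists>s0\<in>I. grad F (\<alpha> s0) \<bullet> t s0 = 0)
          \<longrightarrow> (\<exists>c. \<alpha> ` I \<subseteq> level_set F U c))"
proof -
  note fr = assms(7)[unfolded rotation_minimizing_frame_def, rule_format]
  have C2F: "Ck_on 2 F U" using assms(2) by (simp add: smooth_on_def)
  have perf: "at s within I \<noteq> bot" if "s \<in> I" for s
    using nondegenerate_interval_perfect assms(3) that by blast
  have conv: "convex I"
    using assms(3) by (simp add: nondegenerate_interval_def is_interval_convex)
  have \<alpha>: "(\<alpha> has_vector_derivative t s) (at s within I)" if "s \<in> I" for s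
    using C2_curve_velocity_differentiable(1)[OF assms(5) perf _ that] fr by blast
  have inU: "\<alpha> s \<in> U" if "s \<in> I" for s using assms(4) that by auto
  \<comment> \<open>\<open>d1\<close> and \<open>d2\<close> are the first and second derivatives of \<open>F \<circ> \<alpha>\<close>; both directions rest
    on them.\<close>
  have d1: "((\<lambda>s. F (\<alpha> s)) has_real_derivative grad F (\<alpha> s) \<bullet> t s) (at s within I)" if "s \<in> I" for s
  proof -
    have "F differentiable (at (\<alpha> s))"
      using C2F assms(1) inU[OF that]
      by (auto simp: numeral_2_eq_2 differentiable_on_eq_differentiable_at)
    from has_derivative_compose[OF \<alpha>[OF that, unfolded has_vector_derivative_def] has_derivative_grad[OF this]]
    show ?thesis by (simp add: has_field_derivative_def mult_commute_abs)
  qed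
  have grad: "((\<lambda>s. grad F (\<alpha> s)) has_vector_derivative Hess F (\<alpha> s) *v t s) (at s within I)"
    if "s \<in> I" for s
    using has_derivative_compose[OF \<alpha>[OF that, unfolded has_vector_derivative_def]
        grad_has_derivative_Hess[OF assms(1) inU[OF that] C2F]]
    by (simp add: has_vector_derivative_def matrix_vector_mult_scaleR)
  have d2: "((\<lambda>s. grad F (\<alpha> s) \<bullet> t s) has_real_derivative
      b2 s * \<kappa>2 s + b1 s * \<kappa>1 s + b0 s) (at s within I)" if "s \<in> I" for s
    using has_vector_derivative_inner[OF grad[OF that]
        rotation_minimizing_frame_tangent_derivative[OF assms(7,5) perf that]]
    by (simp add: assms(8-10) inner_add_right algebra_simps)
  have "b2 s * \<kappa>2 s + b1 s * \<kappa>1 s + b0 s = 0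
      \<and> (b1 has_real_derivative (Hess F (\<alpha> s) *v t s) \<bullet> n1 s) (at s within I)
      \<and> (b2 has_real_derivative (Hess F (\<alpha> s) *v t s) \<bullet> n2 s) (at s within I)"
    if lev: "\<alpha> ` I \<subseteq> level_set F U c" and s: "s \<in> I" for c s
  proof -
    have orth: "grad F (\<alpha> u) \<bullet> t u = 0" if "u \<in> I" for u
      by (rule DERIV_of_constant_on[OF perf[OF that] that _ d1[OF that], of c])
         (use lev in \<open>auto simp: level_set_def\<close>)
    have "b2 s * \<kappa>2 s + b1 s * \<kappa>1 s + b0 s = 0"
      by (rule DERIV_of_constant_on[OF perf[OF s] s orth d2[OF s]])
    moreover have "((\<lambda>s. grad F (\<alpha> s) \<bullet> n s) has_real_derivative (Hess F (\<alpha> s) *v t s) \<bullet> n s) (at s within I)"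
      if "(n has_vector_derivative - k *\<^sub>R t s) (at s within I)" for n k
      using has_vector_derivative_inner[OF grad[OF s] that] orth[OF s] by simp
    ultimately show ?thesis using fr[OF s] unfolding assms(9,10) by blast
  qed
  moreover have "\<exists>c. \<alpha> ` I \<subseteq> level_set F U c"
    if eq: "\<forall>s\<in>I. b2 s * \<kappa>2 s + b1 s * \<kappa>1 s + b0 s = 0"
      and s0: "s0 \<in> I" "grad F (\<alpha> s0) \<bullet> t s0 = 0" for s0
  proof -
    have "((\<lambda>s. grad F (\<alpha> s) \<bullet> t s) has_real_derivative 0) (at s within I)" if "s \<in> I" for s
      using d2[OF that] eq that by simp
    from has_field_derivative_zero_constant[OF conv this]
    have orth: "\<forall>s\<in>I. grad F (\<alpha> s) \<bullet> t s = 0" using s0 by auto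
    have "((\<lambda>s. F (\<alpha> s)) has_real_derivative 0) (at s within I)" if "s \<in> I" for s
      using d1[OF that] orth that by simp
    from has_field_derivative_zero_constant[OF conv this]
    obtain c where "\<forall>s\<in>I. F (\<alpha> s) = c" by blast
    then show ?thesis using inU by (auto simp: level_set_def)
  qed
  ultimately show ?thesis by blast
qed

end
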